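(* For every Dyck path $a \in \mathcal{D}$ we have $$ f(u a d) = \sum_{s \ge a} \mathrm{v}(a,s)\, I(s), $$ where the sum is over all Dyck paths $s$ with $|s|=|a|$ and $s \ge a$.
   Context: A (binary) path of length $n$ is a lattice path $P=p_1\cdots p_n$ starting at the origin, each step being an upstep $u=(1,1)$ or a downstep $d=(1,-1)$; $|P|=n$ is its length, $\varepsilon$ the empty path, $\mathcal{P}_n$ the set of paths of length $n$, $\mathcal{P}=\bigcup_{n\ge0}\mathcal{P}_n$, and $[h]=\{1,\dots,h\}$. The height of a point of $P$ is its $y$-coordinate. $\mathcal{P}_n$ is ordered by $P\le Q$ iff $P$ lies weakly below $Q$ (at each abscissa the height of $P$ is at most that of $Q$); its maximum is $\mathbf{1}_n=u^n$. $[P,Q]$ denotes the set of paths $R$ with $P\le R\le Q$. A valley of $P$ is the last point of a maximal run of $d$'s: it is either the middle point of an occurrence of $du$, or the endpoint of $P$ when $P$ ends with $d$. Turning a valley into a peak means replacing the corresponding $du$ by $ud$ (or, for a valley at the end of the path, the final $d$ by $u$). The filling of $P$ is the path $\widetilde P$ obtained by turning every valley of $P$ into a peak (so $\widetilde{\mathbf 1_n}=\mathbf 1_n$). Put $P^{(0)}=P$, $P^{(i)}=\widetilde{P^{(i-1)}}$; the degree $\delta(P)$ is the least $k\ge0$ with $P^{(k)}=\mathbf 1_{|P|}$. A chain $P_0\le P_1\le\cdots\le P_k$ (of length $k$) has small intervals if for each $i\in[k]$ the path $P_i$ is obtained from $P_{i-1}$ by turning some valleys of $P_{i-1}$ into peaks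 (equivalently $P_{i-1}\le P_i\le\widetilde{P_{i-1}}$). $f(P)$ is the number of chains of length $\delta(P)$ with small intervals from $P$ to $\mathbf 1_{|P|}$. A Dyck path is a path that ends at height $0$ and never goes below height $0$; $\mathcal{D}$ is the set of Dyck paths (including $\varepsilon$). $I(s)=|[s,u^{|s|/2}d^{|s|/2}]|$ for $s\in\mathcal D$. For a nonempty Dyck path $\sigma$, $\mathrm{hv}(\sigma)$ is the height of its highest valley (the endpoint of $\sigma$ counts as a valley). A multichain of Dyck paths $\sigma_0\le\sigma_1\le\cdots\le\sigma_h$ (all of the same length), with $h=\mathrm{hv}(\sigma_0)$, is of type $\mathrm v$ if for every $j\in[h]$ the paths $\sigma_j$ and $\sigma_{j-1}$ have the same valleys (as points of the plane) at every height at most $h-j$. For Dyck paths $a\le s$, $\mathrm v(a,s)$ is the number of multichains of type $\mathrm v$ with $\sigma_0=a$ and $\sigma_h=s$; by convention $\mathrm v(\varepsilon,\varepsilon)=1$. *)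

theory Defs
  imports Main
begin

datatype step = Up | Down

type_synonym path = "step list"

primrec step_rise :: "step \<Rightarrow> int" where
  "step_rise Up = 1"
| "step_rise Down = -1"

definition height :: "path \<Rightarrow> nat \<Rightarrow> int" where
  "height P x = sum_list (map step_rise (take x P))"

definition path_le :: "path \<Rightarrow> path \<Rightarrow> bool"  (infix \<open>\<preceq>\<close> 50) where
  "P \<preceq> Q \<longleftrightarrow> length P = length Q \<and> (\<forall>x\<le>length P. height P x \<le> height Q x)"

definition path_interval :: "path \<Rightarrow> path \<Rightarrow> path set" where
  "path_interval P Q = {R. P \<preceq> R \<and> R \<preceq> Q}"

definition top_path :: "nat \<Rightarrow> path" where
  "top_path n = replicate n Up"

text \<open>A valley is represented by its abscissa. The step ending at abscissa \<open>x\<close> is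
  \<open>P ! (x - 1)\<close> and the one starting there is \<open>P ! x\<close>; the endpoint of a path ending
  with a downstep is a valley.\<close>

definition valleys :: "path \<Rightarrow> nat set" where
  "valleys P = {x. 1 \<le> x \<and> x \<le> length P \<and> P ! (x - 1) = Down \<and>
                   (x = length P \<or> P ! x = Up)}"

definition valley_points :: "path \<Rightarrow> (nat \<times> int) set" where
  "valley_points P = (\<lambda>x. (x, height P x)) ` valleys P"

text \<open>For \<open>V \<subseteq> valleys P\<close>, the path \<open>turn_valleys P V\<close> arises from \<open>P\<close> by turning the valleys in
  \<open>V\<close> into peaks: the step ending at such a valley becomes an upstep, the step starting there
  (if any) a downstep. Distinct valleys do not share a step, so the replacements do not
  interfere.\<close>

definition turn_valleys :: "path \<Rightarrow> nat set \<Rightarrow> path" where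
  "turn_valleys P V =
     map (\<lambda>k. if Suc k \<in> V then Up else if k \<in> V then Down else P ! k) [0..<length P]"

definition filling :: "path \<Rightarrow> path" where
  "filling P = turn_valleys P (valleys P)"

definition degree :: "path \<Rightarrow> nat" where
  "degree P = (LEAST k. (filling ^^ k) P = top_path (length P))"

text \<open>A chain \<open>P\<^sub>0, \<dots>, P\<^sub>k\<close> of length \<open>k\<close> is a list with \<open>k + 1\<close> entries. The set of valleys
  turned in a step may be empty.\<close>

definition small_intervals :: "path list \<Rightarrow> bool" where
  "small_intervals c \<longleftrightarrow>
     (\<forall>i\<in>{1..<length c}. c ! (i - 1) \<preceq> c ! i \<and>
        (\<exists>V\<subseteq>valleys (c ! (i - 1)). c ! i = turn_valleys (c ! (i - 1)) V))"

definition small_chain_count :: "path \<Rightarrow> nat" where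
  "small_chain_count P =
     card {c. length c = Suc (degree P) \<and> c ! 0 = P \<and> c ! degree P = top_path (length P) \<and>
              small_intervals c}"

definition dyck :: "path \<Rightarrow> bool" where
  "dyck P \<longleftrightarrow> height P (length P) = 0 \<and> (\<forall>x\<le>length P. 0 \<le> height P x)"

definition upper_count :: "path \<Rightarrow> nat" where
  "upper_count s =
     card (path_interval s (replicate (length s div 2) Up @ replicate (length s div 2) Down))"

text \<open>Meant for nonempty Dyck paths: their valleys have nonnegative height, and the endpoint
  is one of them.\<close>

definition highest_valley :: "path \<Rightarrow> nat" where
  "highest_valley P = nat (Max (height P ` valleys P))"

definition type_v :: "path list \<Rightarrow> bool" where
  "type_v c \<longleftrightarrow>
     (let h = highest_valley (c ! 0) in
       length c = Suc h \<and>
       (\<forall>\<sigma>\<in>set c. dyck \<sigma>) \<and>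
       (\<forall>j\<in>{1..h}. c ! (j - 1) \<preceq> c ! j \<and>
          {p \<in> valley_points (c ! j). snd p \<le> int h - int j} =
          {p \<in> valley_points (c ! (j - 1)). snd p \<le> int h - int j}))"

definition v_count :: "path \<Rightarrow> path \<Rightarrow> nat" where
  "v_count a s =
     (if a = [] then (if s = [] then 1 else 0)
      else card {c. type_v c \<and> c ! 0 = a \<and> c ! highest_valley a = s})"

end

(* Think of a small chain from u a d to the top as a filling of the unit cells above u a d, where
   the cell lifting an abscissa from height y to y + 2 is filled at a time T, strictly increasing
   along the order of the cells. Ranked by y, the cells form a poset with a single maximal element,
   and all maximal chains above a cell have the same length; a chain of length degree (u a d) must
   satisfy T <= y + 1. The slack g = y + 1 - T is then weakly decreasing upwards and at most y. As
   the end of u a d is a valley of height 0, g vanishes on every cell above it, which leaves only the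
   cells below the pyramid. Hence the sets {g >= k}, k >= 1, are lower sets: they amount to a
   decreasing sequence of Dyck paths above a ("layers"), the k-th of which is obtained from a by
   filling cells of height at least k - 1 (measured in a). The first layer is an arbitrary Dyck path
   above the second one, which gives the factor I(s); the others, read backwards, form a multichain of
   type v, because fixing all valleys of height at most H is the same as fixing all points of height
   at most H. *)

theory Submission
  imports Defs
begin

section \<open>Heights, parity and the order on paths\<close>

lemma height_0 [simp]: "height P 0 = 0"
  by (simp add: height_def)

lemma height_Suc: "x < length P \<Longrightarrow> height P (Suc x) = height P x + step_rise (P ! x)"
  by (simp add: height_def take_Suc_conv_app_nth)

lemma height_Suc_cases:
  assumes "x < length P"
  obtains "P ! x = Up" "height P (Suc x) = height P x + 1"
  | "P ! x = Down" "height P (Suc x) = height P x - 1"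
  using assms by (cases "P ! x") (auto simp: height_Suc)

lemma nth_eq_iff_height:
  assumes "x < length P"
  shows "P ! x = Up \<longleftrightarrow> height P (Suc x) = height P x + 1"
    and "P ! x = Down \<longleftrightarrow> height P (Suc x) = height P x - 1"
  using assms by (auto elim: height_Suc_cases)

lemma height_parity: "x \<le> length P \<Longrightarrow> even (int x + height P x)"
proof (induction x)
  case (Suc x)
  then have "x < length P" by simp
  then show ?case using Suc by (cases rule: height_Suc_cases) auto
qed simp

lemma height_le_abscissa: "x \<le> length P \<Longrightarrow> height P x \<le> int x"
proof (induction x)
  case (Suc x)
  then have "x < length P" by simp
  then show ?case using Suc by (cases rule: height_Suc_cases) auto
qed simp

lemma height_Suc_bounds:
  assumes "x < length P"
  shows "height P (Suc x) \<le> height P x + 1" "height P x \<le> height P (Suc x) + 1"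
  using assms by (auto elim: height_Suc_cases)

lemma height_Suc_neq: "x < length P \<Longrightarrow> height P (Suc x) \<noteq> height P x"
  by (auto elim: height_Suc_cases)

lemma path_eqI:
  assumes len: "length P = length Q" and h: "\<And>x. x \<le> length P \<Longrightarrow> height P x = height Q x"
  shows "P = Q"
proof (rule nth_equalityI [OF len])
  fix i assume i: "i < length P"
  have "step_rise (P ! i) = step_rise (Q ! i)"
    using height_Suc [OF i] height_Suc [of i Q] h [of i] h [of "Suc i"] i len by simp
  then show "P ! i = Q ! i" by (cases "P ! i"; cases "Q ! i") auto
qed

lemma path_le_refl [simp]: "P \<preceq> P"
  by (simp add: path_le_def)

lemma path_le_trans: "P \<preceq> Q \<Longrightarrow> Q \<preceq> R \<Longrightarrow> P \<preceq> R"
  by (fastforce simp: path_le_def intro: order_trans)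

lemma path_leD: "P \<preceq> Q \<Longrightarrow> x \<le> length P \<Longrightarrow> height P x \<le> height Q x"
  by (simp add: path_le_def)

lemma path_le_length: "P \<preceq> Q \<Longrightarrow> length P = length Q"
  by (simp add: path_le_def)

lemma finite_paths: "finite {P :: path. length P = n}"
proof -
  have eq: "(UNIV :: step set) = {Up, Down}" by (auto intro: step.exhaust)
  have "finite (UNIV :: step set)" unfolding eq by simp
  from finite_lists_length_eq [OF this, of n] show ?thesis by simp
qed

section \<open>Paths as order ideals\<close>

text \<open>Paths are compared and constructed through the lattice points lying weakly below them. Only
  points \<open>(x, z)\<close> with \<open>x + z\<close> even matter; predicates are unconstrained elsewhere.\<close>

definition below :: "path \<Rightarrow> (nat \<Rightarrow> int \<Rightarrow> bool) \<Rightarrow> bool" where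
  "below P R \<longleftrightarrow> (\<forall>x\<le>length P. \<forall>z. even (int x + z) \<longrightarrow> (z \<le> height P x \<longleftrightarrow> R x z))"

definition path_of :: "nat \<Rightarrow> (nat \<Rightarrow> int \<Rightarrow> bool) \<Rightarrow> path" where
  "path_of n R = (THE P. length P = n \<and> below P R)"

lemma belowD:
  "below P R \<Longrightarrow> x \<le> length P \<Longrightarrow> even (int x + z) \<Longrightarrow> z \<le> height P x \<longleftrightarrow> R x z"
  by (simp add: below_def)

lemma below_height: "below P R \<Longrightarrow> x \<le> length P \<Longrightarrow> R x (height P x)"
  using belowD [of P R x "height P x"] height_parity [of x P] by blast

lemma below_le:
  assumes "below P R" "below Q S" "length P = length Q"
    and "\<And>x z. x \<le> length P \<Longrightarrow> even (int x + z) \<Longrightarrow> R x z \<Longrightarrow> S x z"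
  shows "P \<preceq> Q"
  unfolding path_le_def
proof (intro conjI allI impI)
  fix x assume "x \<le> length P"
  with assms have "S x (height P x)"
    using below_height [of P R x] height_parity [of x P] by blast
  with \<open>x \<le> length P\<close> assms show "height P x \<le> height Q x"
    using belowD [of Q S x "height P x"] height_parity [of x P] by simp
qed fact

lemma path_le_antisym: "P \<preceq> Q \<Longrightarrow> Q \<preceq> P \<Longrightarrow> P = Q"
  by (rule path_eqI) (auto simp: path_le_def intro: order_antisym)

lemma below_unique:
  assumes "below P R" "below Q S" "length P = length Q"
    and "\<And>x z. x \<le> length P \<Longrightarrow> even (int x + z) \<Longrightarrow> R x z \<longleftrightarrow> S x z"
  shows "P = Q"
proof (rule path_le_antisym)
  show "P \<preceq> Q" by (rule below_le [OF assms(1-3)]) (simp add: assms(4))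
  show "Q \<preceq> P"
    by (rule below_le [OF assms(2,1) assms(3) [symmetric]]) (simp add: assms(3,4))
qed

lemma below_self: "below P (\<lambda>x z. z \<le> height P x)"
  by (simp add: below_def)

text \<open>These are the sets of points weakly below a path of length \<open>n\<close>. Going to a
  neighbouring column and back also gives closure from \<open>z\<close> to \<open>z - 2\<close>
  within a column.\<close>

definition ideal :: "nat \<Rightarrow> (nat \<Rightarrow> int \<Rightarrow> bool) \<Rightarrow> bool" where
  "ideal n R \<longleftrightarrow> (\<forall>z. even z \<longrightarrow> R 0 z = (z \<le> 0)) \<and>
     (\<forall>x<n. \<forall>z. (even (int x + z) \<longrightarrow> R x z \<longrightarrow> R (Suc x) (z - 1)) \<and>
                (even (int (Suc x) + z) \<longrightarrow> R (Suc x) z \<longrightarrow> R x (z - 1)))"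

text \<open>Induction on \<open>n\<close>, appending one step. Column \<open>n\<close> forces
  everything up to \<open>?y - 1\<close> into column \<open>Suc n\<close> and everything above
  \<open>?y + 1\<close> out of it, so membership of \<open>?y + 1\<close> alone decides the
  step.\<close>

lemma ideal_path_ex:
  "ideal n R \<Longrightarrow> \<exists>P. length P = n \<and> below P R"
proof (induction n)
  case 0
  then show ?case by (auto simp: ideal_def below_def)
next
  case (Suc n)
  then have "ideal n R" by (simp add: ideal_def)
  with Suc.IH obtain P where P: "length P = n" "below P R" by blast
  let ?y = "height P n"
  have par: "even (int n + ?y)" using height_parity [of n P] P by simp
  have up: "R n z \<Longrightarrow> R (Suc n) (z - 1)" if "even (int n + z)" for z
    using Suc.prems that by (simp add: ideal_def)
  have dn: "R (Suc n) z \<Longrightarrow> R n (z - 1)" if "odd (int n + z)" for z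
    using Suc.prems that by (simp add: ideal_def)
  have Rn: "z \<le> ?y \<longleftrightarrow> R n z" if "even (int n + z)" for z
    using belowD [OF P(2)] P(1) that by simp
  define s where "s = (if R (Suc n) (?y + 1) then Up else Down)"
  let ?Q = "P @ [s]"
  have old: "height ?Q x = height P x" if "x \<le> n" for x
    using that P(1) by (simp add: height_def)
  have new: "height ?Q (Suc n) = ?y + step_rise s"
    using P(1) by (simp add: height_def)
  have "z \<le> height ?Q (Suc n) \<longleftrightarrow> R (Suc n) z" if z: "odd (int n + z)" for z
  proof -
    \<comment> \<open>Parity excludes \<open>z = ?y\<close>.\<close>
    consider "z \<le> ?y - 1" | "z = ?y + 1" | "z > ?y + 1"
      using z par by (metis add_less_cancel_left linorder_less_linear zle_diff1_eq
          zless_imp_add1_zle order_le_less)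
    then show ?thesis
    proof cases
      case 1
      then have "R n (z + 1)" using Rn [of "z + 1"] z by simp
      then have "R (Suc n) z" using up [of "z + 1"] z by simp
      then show ?thesis using 1 new by (cases s) auto
    next
      case 2
      then show ?thesis using new by (simp add: s_def)
    next
      case 3
      then have "\<not> R n (z - 1)" using Rn [of "z - 1"] z by simp
      then have "\<not> R (Suc n) z" using dn [of z] z by blast
      then show ?thesis using 3 new by (cases s) auto
    qed
  qed
  then have "below ?Q R"
    using P old by (auto simp: below_def le_Suc_eq)
  then show ?case using P(1) by (intro exI [of _ ?Q]) simp
qed

lemma path_of:
  assumes "ideal n R"
  shows length_path_of: "length (path_of n R) = n" and below_path_of: "below (path_of n R) R"
proof -
  have "\<exists>!P. length P = n \<and> below P R"
    using ideal_path_ex [OF assms] below_unique by blast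
  from theI' [OF this] show "length (path_of n R) = n" "below (path_of n R) R"
    by (auto simp: path_of_def)
qed

section \<open>Valleys and small intervals\<close>

text \<open>Heights, unlike steps, can be compared directly between two paths, so later arguments
  read valleys off neighbouring heights.\<close>

lemma valleys_iff_height:
  "x \<in> valleys P \<longleftrightarrow> 1 \<le> x \<and> x \<le> length P \<and> height P (x - 1) = height P x + 1 \<and>
     (x = length P \<or> height P (Suc x) = height P x + 1)"
proof (cases "1 \<le> x \<and> x \<le> length P")
  case True
  then obtain y where y: "x = Suc y" "y < length P" by (cases x) auto
  have "P ! y = Down \<longleftrightarrow> height P y = height P x + 1"
    using nth_eq_iff_height(2) [OF y(2)] y(1) by auto
  moreover have "P ! x = Up \<longleftrightarrow> height P (Suc x) = height P x + 1" if "x \<noteq> length P"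
    using nth_eq_iff_height(1) [of x P] that True by linarith
  ultimately show ?thesis using True y(1) by (auto simp: valleys_def)
qed (auto simp: valleys_def)

lemma length_turn_valleys [simp]: "length (turn_valleys P V) = length P"
  by (simp add: turn_valleys_def)

text \<open>Turning the step before a valley gains 2 and turning the step after it loses 2, so the
  effect is confined to one abscissa.\<close>

lemma height_turn_valleys:
  assumes V: "V \<subseteq> valleys P" and "x \<le> length P"
  shows "height (turn_valleys P V) x = height P x + (if x \<in> V then 2 else 0)"
  using \<open>x \<le> length P\<close>
proof (induction x)
  case 0
  have "0 \<notin> V" using V by (auto simp: valleys_def)
  then show ?case by simp
next
  case (Suc x)
  then have x: "x < length P" by simp
  have nth: "turn_valleys P V ! x = (if Suc x \<in> V then Up else if x \<in> V then Down else P ! x)"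
    using x by (simp add: turn_valleys_def)
  have 1: "P ! x = Down \<and> x \<notin> V" if "Suc x \<in> V"
    using subsetD [OF V that] subsetD [OF V, of x] x by (auto simp: valleys_def)
  have 2: "P ! x = Up" if "x \<in> V"
    using that V x by (fastforce simp: valleys_def)
  show ?case
    using Suc.IH x nth 1 2 by (auto simp: height_Suc)
qed

text \<open>For \<open>x > 0\<close>, the height of \<open>filling P\<close> at \<open>x\<close> is
  one more than the lowest neighbouring height of \<open>P\<close>. The bounds thus say that
  \<open>Q\<close> lies weakly below \<open>filling P\<close>.\<close>

definition small_step :: "path \<Rightarrow> path \<Rightarrow> bool" where
  "small_step P Q \<longleftrightarrow> P \<preceq> Q \<and> (\<forall>x<length P. height Q x \<le> height P (Suc x) + 1 \<and>
     height Q (Suc x) \<le> height P x + 1)"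

text \<open>Where \<open>Q\<close> exceeds \<open>P\<close>, parity makes the excess at least 2; the
  bounds then force the neighbours in \<open>P\<close> up, which gives a valley and an excess of
  exactly 2. Hence \<open>V\<close> consists of these abscissae.\<close>

lemma small_step_iff:
  "small_step P Q \<longleftrightarrow> P \<preceq> Q \<and> (\<exists>V\<subseteq>valleys P. Q = turn_valleys P V)"
proof
  assume *: "P \<preceq> Q \<and> (\<exists>V\<subseteq>valleys P. Q = turn_valleys P V)"
  then obtain V where V: "V \<subseteq> valleys P" "Q = turn_valleys P V" by blast
  have "height Q x \<le> height P (Suc x) + 1 \<and> height Q (Suc x) \<le> height P x + 1"
    if x: "x < length P" for x
  proof -
    have "height P (Suc x) = height P x + 1" if "x \<in> V"
      using that V(1) x by (auto simp: valleys_iff_height)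
    moreover have "height P (Suc x) + 1 = height P x" if "Suc x \<in> V"
      using that V(1) x by (auto simp: valleys_iff_height)
    ultimately show ?thesis
      using V height_turn_valleys [OF V(1)] x height_Suc_bounds [OF x] by auto
  qed
  with * show "small_step P Q" by (simp add: small_step_def)
next
  assume s: "small_step P Q"
  then have le: "P \<preceq> Q" by (simp add: small_step_def)
  note len = path_le_length [OF le]
  define V where "V = {x. x \<le> length P \<and> height P x < height Q x}"
  have *: "x \<in> valleys P \<and> height Q x = height P x + 2" if "x \<in> V" for x
  proof -
    have x: "x \<le> length P" "height P x < height Q x" using that by (auto simp: V_def)
    have x0: "x \<noteq> 0" using x(2) by (intro notI) simp
    then obtain y where y: "x = Suc y" "y < length P" using x by (cases x) auto
    have ge: "height Q x \<ge> height P x + 2"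
      using height_parity [of x P] height_parity [of x Q] x len
      by (cases "height Q x = height P x + 1") auto
    have left: "height P y = height P x + 1" "height Q x = height P x + 2"
      using s y ge height_Suc_bounds [of y P] by (auto simp: small_step_def)
    have right: "height P (Suc x) = height P x + 1" if "x \<noteq> length P"
    proof -
      have "x < length P" using that x by simp
      then have "height Q x \<le> height P (Suc x) + 1" "height P (Suc x) \<le> height P x + 1"
        using s height_Suc_bounds [of x P] by (auto simp: small_step_def)
      then show ?thesis using ge by linarith
    qed
    show ?thesis using left right y by (auto simp: valleys_iff_height)
  qed
  then have V: "V \<subseteq> valleys P" by blast
  have "Q = turn_valleys P V"
  proof (rule path_eqI)
    fix x assume "x \<le> length Q"
    then show "height Q x = height (turn_valleys P V) x"
      using height_turn_valleys [OF V, of x] * [of x] path_leD [OF le, of x] len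
      by (auto simp: V_def)
  qed (simp add: len)
  with V le show "P \<preceq> Q \<and> (\<exists>V\<subseteq>valleys P. Q = turn_valleys P V)" by blast
qed

lemma small_intervals_iff:
  "small_intervals c \<longleftrightarrow> (\<forall>i. Suc i < length c \<longrightarrow> small_step (c ! i) (c ! Suc i))"
proof -
  have "(\<forall>i\<in>{1..<n}. S (i - 1) i) \<longleftrightarrow> (\<forall>i. Suc i < n \<longrightarrow> S i (Suc i))" for n :: nat and S
    by (metis One_nat_def Suc_le_eq atLeastLessThan_iff diff_Suc_1 le_numeral_extra(4)
        less_eq_Suc_le not0_implies_Suc not_less_zero zero_less_Suc)
  from this [of "length c" "\<lambda>i j. small_step (c ! i) (c ! j)"]
  show ?thesis by (simp add: small_intervals_def small_step_iff)
qed

lemma small_step_filling: "small_step P (filling P)"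
proof -
  have "P \<preceq> filling P"
    using height_turn_valleys [of "valleys P" P] by (auto simp: path_le_def filling_def)
  then show ?thesis by (auto simp: small_step_iff filling_def)
qed

lemma length_top_path [simp]: "length (top_path n) = n"
  by (simp add: top_path_def)

lemma height_top_path [simp]: "x \<le> n \<Longrightarrow> height (top_path n) x = int x"
  by (simp add: top_path_def height_def sum_list_replicate min_def)

lemma small_step_length: "small_step P Q \<Longrightarrow> length Q = length P"
  by (simp add: small_step_def path_le_def)

lemma small_step_bounds:
  assumes "small_step P Q"
  shows "x \<le> length P \<Longrightarrow> height P x \<le> height Q x"
    and "x < length P \<Longrightarrow> height Q x \<le> height P (Suc x) + 1"
    and "x < length P \<Longrightarrow> height Q (Suc x) \<le> height P x + 1"
  using assms by (auto simp: small_step_def path_le_def)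

section \<open>Chains starting from Dyck paths, and the degree\<close>

lemma dyck_height_le:
  assumes "dyck P" "x \<le> length P"
  shows "height P x \<le> int (length P) - int x"
proof -
  have "height P (length P - d) \<le> int d" if "d \<le> length P" for d
    using that
  proof (induction d)
    case 0
    then show ?case using assms by (simp add: dyck_def)
  next
    case (Suc d)
    then have "length P - Suc d < length P" by linarith
    from height_Suc_bounds(2) [OF this] Suc show ?case by (simp add: Suc_diff_Suc)
  qed
  from this [of "length P - x"] assms(2) show ?thesis by (simp add: of_nat_diff)
qed

lemma even_length_dyck: "dyck P \<Longrightarrow> even (length P)"
  using height_parity [of "length P" P] by (simp add: dyck_def)

lemma dyck_height_nonneg: "dyck P \<Longrightarrow> x \<le> length P \<Longrightarrow> 0 \<le> height P x"
  by (simp add: dyck_def)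

lemma small_chain_length:
  assumes "\<And>i. i < k \<Longrightarrow> small_step (c i) (c (Suc i))" "i \<le> k"
  shows "length (c i) = length (c 0)"
  using assms(2)
proof (induction i)
  case (Suc i)
  then show ?case using small_step_length [OF assms(1) [of i]] by simp
qed simp

text \<open>A small step bounds the new height at \<open>x\<close> by the old one at
  \<open>Suc x\<close> plus 1, so both terms of the maximum carry over to \<open>Suc i\<close>; the
  last column uses its left neighbour. This limits how early cells beyond the pyramid can be
  filled.\<close>

lemma small_chain_upper:
  assumes step: "\<And>i. i < k \<Longrightarrow> small_step (c i) (c (Suc i))"
    and P: "dyck (c 0)" "c 0 \<noteq> []" and "i \<le> k" "x \<le> length (c 0)"
  shows "height (c i) x \<le> max (int i + 1) (int (length (c 0)) - int x)"
  using assms(4,5)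
proof (induction i arbitrary: x)
  case 0
  then show ?case using dyck_height_le [OF P(1), of x] by simp
next
  case (Suc i)
  have len: "length (c i) = length (c 0)"
    using small_chain_length [of k c i] step Suc.prems by simp
  have i: "i < k" using Suc.prems by simp
  show ?case
  proof (cases "x = length (c 0)")
    case True
    with P(2) have "x \<noteq> 0" by auto
    then obtain y where y: "x = Suc y" by (cases x) simp_all
    show ?thesis
      using small_step_bounds(3) [OF step [OF i], of y] Suc.IH [of y] y True len Suc.prems by simp
  next
    case False
    then show ?thesis
      using small_step_bounds(2) [OF step [OF i], of x] Suc.IH [of "Suc x"] len Suc.prems by simp
  qed
qed

text \<open>Deadlines, by induction backwards from the top: if a neighbour has reached
  \<open>z + 1\<close> at time \<open>Suc i\<close>, a small step needs \<open>z\<close> at time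
  \<open>i\<close>.\<close>

lemma small_chain_lower:
  assumes step: "\<And>i. i < k \<Longrightarrow> small_step (c i) (c (Suc i))"
    and top: "c k = top_path (Suc k)"
    and "i \<le> k" "x \<le> Suc k" "even (int x + z)" "z \<le> int x" "z \<le> int i + 1"
  shows "z \<le> height (c i) x"
  using assms(3-)
proof (induction i arbitrary: x z rule: inc_induct)
  case base
  then show ?case using top by simp
next
  case (step i)
  note st = assms(1) [OF \<open>i < k\<close>]
  have len: "length (c i) = Suc k"
    using small_chain_length [of k c k] small_chain_length [of k c i] assms(1) step.hyps top by simp
  show ?case
  proof (cases "x = Suc k")
    case True
    \<comment> \<open>The last column has only its left neighbour, column \<open>k\<close>; parity
      leaves room for \<open>z + 1\<close> there.\<close>
    have "z \<noteq> int x" using True step.prems step.hyps by linarith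
    moreover have "z \<noteq> int x - 1" using \<open>even (int x + z)\<close> by auto
    ultimately have "z + 1 \<le> int k" using \<open>z \<le> int x\<close> True by linarith
    moreover have "even (int k + (z + 1))" using \<open>even (int x + z)\<close> True by auto
    ultimately have "z + 1 \<le> height (c (Suc i)) k"
      using step.prems by (intro step.IH) simp_all
    then show ?thesis using small_step_bounds(2) [OF st, of k] len True by simp
  next
    case False
    then have "z + 1 \<le> height (c (Suc i)) (Suc x)"
      using step.IH [of "Suc x" "z + 1"] step.prems by simp
    then show ?thesis using small_step_bounds(3) [OF st, of x] len False step.prems by simp
  qed
qed

lemma length_filling [simp]: "length (filling P) = length P"
  by (simp add: filling_def)

lemma length_filling_funpow [simp]: "length ((filling ^^ k) P) = length P"
  by (induction k) auto

text \<open>If column \<open>x\<close> falls short of the claim for \<open>Suc k\<close>, its height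
  is exactly \<open>k\<close> and \<open>k < x\<close>. Its neighbours are at least that high by
  induction, hence higher, so \<open>x\<close> is a valley and gets filled.\<close>

lemma height_filling_funpow_ge:
  assumes "dyck P" "x \<le> length P"
  shows "min (int x) (int k) \<le> height ((filling ^^ k) P) x"
  using assms(2)
proof (induction k arbitrary: x)
  case 0
  then show ?case using assms(1) by (simp add: dyck_def)
next
  case (Suc k)
  let ?Q = "(filling ^^ k) P"
  have Q: "height ((filling ^^ Suc k) P) x = height ?Q x + (if x \<in> valleys ?Q then 2 else 0)"
    using height_turn_valleys [of "valleys ?Q" ?Q x] Suc.prems by (simp add: filling_def)
  show ?case
  proof (cases "min (int x) (int k + 1) \<le> height ?Q x")
    case False
    then have k: "k < x" "height ?Q x = int k" using Suc.IH [OF Suc.prems] by auto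
    then obtain y where y: "x = Suc y" by (cases x) auto
    have "height ?Q y \<ge> int k" using Suc.IH [of y] Suc.prems k y by simp
    then have left: "height ?Q y = int k + 1"
      using height_Suc_bounds(2) [of y ?Q] height_Suc_neq [of y ?Q] Suc.prems y k by simp
    have right: "height ?Q (Suc x) = int k + 1" if "x \<noteq> length P"
    proof -
      have "height ?Q (Suc x) \<ge> int k" using Suc.IH [of "Suc x"] Suc.prems k that by simp
      then show ?thesis 
        using height_Suc_bounds(1) [of x ?Q] height_Suc_neq [of x ?Q] Suc.prems that k by simp
    qed
    have "x \<in> valleys ?Q" using left right k y Suc.prems by (auto simp: valleys_iff_height)
    then show ?thesis using Q k by simp
  qed (use Q in auto)
qed

text \<open>After \<open>length P - 1\<close> fillings every height is at most 1 short of the top,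
  and parity excludes 1. Conversely, \<open>small_chain_upper\<close> keeps the end height at most
  \<open>k + 1\<close> after \<open>k\<close> fillings.\<close>

lemma degree_dyck:
  assumes P: "dyck P" "P \<noteq> []"
  shows "degree P = length P - 1"
  unfolding degree_def
proof (rule Least_equality)
  let ?n = "length P" and ?Q = "(filling ^^ (length P - 1)) P"
  show "?Q = top_path ?n"
  proof (rule path_eqI)
    fix x assume "x \<le> length ?Q"
    then have x: "x \<le> ?n" by simp
    have "height ?Q x \<le> int x" using height_le_abscissa [of x ?Q] x by simp
    moreover have "int x - 1 \<le> height ?Q x"
      using height_filling_funpow_ge [OF P(1) x, of "?n - 1"] x by linarith
    moreover have "height ?Q x \<noteq> int x - 1"
    proof
      assume "height ?Q x = int x - 1"
      with height_parity [of x ?Q] x have "even (int x + (int x - 1))" by simp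
      then show False by presburger
    qed
    ultimately show "height ?Q x = height (top_path ?n) x" using x by simp
  qed simp
next
  fix k assume k: "(filling ^^ k) P = top_path (length P)"
  have "height ((filling ^^ k) P) (length P) \<le> max (int k + 1) 0"
    using small_chain_upper [of k "\<lambda>i. (filling ^^ i) P" k "length P"] P
    by (simp add: small_step_filling)
  then show "length P - 1 \<le> k" using k by simp
qed

text \<open>Lists have \<open>length P\<close> entries since the degree of a nonempty Dyck path is
  \<open>length P - 1\<close>.\<close>

definition small_chains :: "path \<Rightarrow> path list set" where
  "small_chains P = {c. length c = length P \<and> c ! 0 = P \<and>
     c ! (length P - 1) = top_path (length P) \<and>
     (\<forall>i < length P - 1. small_step (c ! i) (c ! Suc i))}"

lemma small_chain_count_dyck:
  assumes "dyck P" "P \<noteq> []"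
  shows "small_chain_count P = card (small_chains P)"
proof -
  have "Suc (degree P) = length P" "degree P = length P - 1"
    using assms by (simp_all add: degree_dyck Suc_diff_le)
  then show ?thesis
    unfolding small_chain_count_def small_chains_def small_intervals_iff
    by (intro arg_cong [where f = card]) (auto simp: less_diff_conv)
qed

section \<open>Layers\<close>

abbreviation lift :: "path \<Rightarrow> path" where
  "lift a \<equiv> Up # a @ [Down]"

lemma height_lift:
  "x \<le> length a \<Longrightarrow> height (lift a) (Suc x) = height a x + 1"
  "height (lift a) (Suc (Suc (length a))) = height a (length a)"
  by (auto simp: height_def)

lemma dyck_lift: "dyck a \<Longrightarrow> dyck (lift a)"
proof -
  assume a: "dyck a"
  have "0 \<le> height (lift a) x" if "x \<le> Suc (Suc (length a))" for x
  proof (cases x)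
    case (Suc y)
    then show ?thesis
      using that a by (cases "y = Suc (length a)") (auto simp: height_lift dyck_def)
  qed simp
  then show ?thesis using a by (simp add: dyck_def height_lift)
qed

text \<open>For Dyck \<open>a\<close>, the lower bound \<open>a\<close> and the end height of
  \<open>t 0\<close> make every layer a Dyck path, and the infinite sequence is constantly
  \<open>a\<close> beyond the highest valley.\<close>

definition layers :: "path \<Rightarrow> (nat \<Rightarrow> path) set" where
  "layers a = {t. (\<forall>k. a \<preceq> t k \<and> t (Suc k) \<preceq> t k) \<and> height (t 0) (length a) = 0 \<and>
     (\<forall>k. \<forall>x\<le>length a. height a x < int k \<longrightarrow> height (t k) x = height a x)}"

lemma layersD:
  assumes "t \<in> layers a"
  shows layers_ge: "a \<preceq> t k"
    and layers_fixed: "x \<le> length a \<Longrightarrow> height a x < int k \<Longrightarrow> height (t k) x = height a x"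
  using assms by (auto simp: layers_def)

lemma layers_length: "t \<in> layers a \<Longrightarrow> length (t k) = length a"
  using layers_ge path_le_length by metis

lemma layers_antimono:
  assumes "t \<in> layers a" "j \<le> k"
  shows "t k \<preceq> t j"
  using assms(2)
proof (induction k rule: dec_induct)
  case (step k)
  have "t (Suc k) \<preceq> t k" using assms(1) by (simp add: layers_def)
  then show ?case using step.IH by (rule path_le_trans)
qed simp

lemma dyck_layers:
  assumes a: "dyck a" and t: "t \<in> layers a"
  shows "dyck (t k)"
proof -
  have "height (t k) (length a) \<le> 0"
    using path_leD [OF layers_antimono [OF t, of 0 k], of "length a"] layers_length [OF t] t
    by (simp add: layers_def)
  moreover have "0 \<le> height (t k) x" if "x \<le> length a" for x
    using path_leD [OF layers_ge [OF t, of k] that] dyck_height_nonneg [OF a that] by simp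
  ultimately show ?thesis using layers_length [OF t, of k] by (auto simp: dyck_def intro: antisym)
qed

text \<open>By parity, a point above \<open>a\<close> is at least 2 above it, so
  \<open>w <= k + 1\<close> puts the height of \<open>a\<close> there below \<open>k\<close>, where
  layer \<open>k\<close> is fixed.\<close>

lemma layers_low:
  assumes t: "t \<in> layers a" and x: "x \<le> length a" and par: "even (int x + w)" and w: "w \<le> int k + 1"
  shows "w \<le> height (t k) x \<longleftrightarrow> w \<le> height a x"
proof
  assume "w \<le> height (t k) x"
  show "w \<le> height a x"
  proof (rule ccontr)
    assume n: "\<not> w \<le> height a x"
    have "height a x \<noteq> w - 1"
    proof
      assume "height a x = w - 1"
      with height_parity [OF x] have "even (int x + (w - 1))" by simp
      with par show False by presburger
    qed
    with n w have "height a x < int k" by linarith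
    then show False using layers_fixed [OF t x] n \<open>w \<le> height (t k) x\<close> by simp
  qed
next
  assume "w \<le> height a x"
  then show "w \<le> height (t k) x" using path_leD [OF layers_ge [OF t] x, of k] by simp
qed

text \<open>The cell that raises the point of \<^term>\<open>lift a\<close> at abscissa \<open>x\<close> to height \<open>z\<close> is filled no
  later than step \<open>z - 1\<close> of a chain; layer \<open>k\<close> collects the cells filled more than \<open>k\<close> steps
  before this deadline (layers are numbered from 0 here). A point \<open>(x, w)\<close> of a layer is the point \<open>(x + 1, w + 1)\<close> of the lifted
  path. The bound \<open>w \<le> int x\<close> only keeps the index within the chain, and \<open>nat\<close> sends negative
  times to the initial path.\<close>

definition layer_ideal :: "path list \<Rightarrow> nat \<Rightarrow> nat \<Rightarrow> int \<Rightarrow> bool" where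
  "layer_ideal c k x w \<longleftrightarrow> w \<le> int x \<and> w + 1 \<le> height (c ! nat (w - int k - 1)) (Suc x)"

text \<open>The first alternative holds the points whose deadline has come by time \<open>i\<close>.
  The second inverts \<open>layer_ideal\<close>: \<open>i = w - k - 1\<close> and
  \<open>w = z - 1\<close> give the layer index \<open>k = z - 2 - i\<close>.\<close>

definition chain_ideal :: "nat \<Rightarrow> (nat \<Rightarrow> path) \<Rightarrow> nat \<Rightarrow> nat \<Rightarrow> int \<Rightarrow> bool" where
  "chain_ideal m t i x z \<longleftrightarrow>
     z \<le> int i + 1 \<and> z \<le> int x \<or>
     int i + 2 \<le> z \<and> 1 \<le> x \<and> x \<le> Suc m \<and> z - 1 \<le> height (t (nat (z - 2 - int i))) (x - 1)"

definition layers_of_chain :: "nat \<Rightarrow> path list \<Rightarrow> nat \<Rightarrow> path" where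
  "layers_of_chain m c k = path_of m (layer_ideal c k)"

definition chain_of_layers :: "nat \<Rightarrow> (nat \<Rightarrow> path) \<Rightarrow> path list" where
  "chain_of_layers m t = map (\<lambda>i. path_of (m + 2) (chain_ideal m t i)) [0..<m + 2]"

section \<open>From chains to layers and back\<close>

lemma small_chainsD:
  assumes "c \<in> small_chains (lift a)"
  shows small_chains_0: "c ! 0 = lift a"
    and small_chains_step: "i \<le> length a \<Longrightarrow> small_step (c ! i) (c ! Suc i)"
    and small_chains_top: "c ! Suc (length a) = top_path (length a + 2)"
    and small_chains_len: "length c = length a + 2"
  using assms by (auto simp: small_chains_def)

lemma small_chains_length:
  assumes "c \<in> small_chains (lift a)" "i \<le> Suc (length a)"
  shows "length (c ! i) = length a + 2"
  using small_chain_length [of "Suc (length a)" "\<lambda>i. c ! i" i] assms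
  by (simp add: small_chains_0 small_chains_step)

lemma small_chains_mono:
  assumes c: "c \<in> small_chains (lift a)" and "i \<le> j" "j \<le> Suc (length a)"
  shows "c ! i \<preceq> c ! j"
  using assms(2,3)
proof (induction j rule: dec_induct)
  case (step j)
  then have "c ! j \<preceq> c ! Suc j" using small_chains_step [OF c, of j] by (simp add: small_step_def)
  with step show ?case using path_le_trans by auto
qed simp

text \<open>For \<open>v <= 0\<close> both times denote the initial path, whose neighbouring heights
  differ by 1 anyway; otherwise this is one small step.\<close>

lemma small_chains_neighbours:
  assumes c: "c \<in> small_chains (lift a)" and "v \<le> int (length a) + 1" "y \<le> Suc (length a)"
  shows "height (c ! nat v) y \<le> height (c ! nat (v - 1)) (Suc y) + 1"
    and "height (c ! nat v) (Suc y) \<le> height (c ! nat (v - 1)) y + 1"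
proof -
  have "height (c ! nat v) y \<le> height (c ! nat (v - 1)) (Suc y) + 1 \<and>
    height (c ! nat v) (Suc y) \<le> height (c ! nat (v - 1)) y + 1"
  proof (cases "v \<le> 0")
    case True
    then show ?thesis
      using height_Suc_bounds [of y "c ! 0"] small_chains_length [OF c, of 0] assms(3) by simp
  next
    case False
    then have "nat v = Suc (nat (v - 1))" by simp
    then show ?thesis
      using small_step_bounds [OF small_chains_step [OF c, of "nat (v - 1)"], of y] assms
        small_chains_length [OF c, of "nat (v - 1)"] by simp
  qed
  then show "height (c ! nat v) y \<le> height (c ! nat (v - 1)) (Suc y) + 1"
    "height (c ! nat v) (Suc y) \<le> height (c ! nat (v - 1)) y + 1" by simp_all
qed

text \<open>Passing to a neighbouring column and from \<open>w\<close> to \<open>w - 1\<close> moves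
  the time \<open>w - k - 1\<close> back by one, so closure is the bound of a small step.\<close>

lemma ideal_layer_ideal:
  assumes c: "c \<in> small_chains (lift a)"
  shows "ideal (length a) (layer_ideal c k)"
  unfolding ideal_def
proof (intro conjI allI impI)
  fix z :: int
  show "layer_ideal c k 0 z = (z \<le> 0)"
    using height_lift(1) [of 0 a] by (auto simp: layer_ideal_def small_chains_0 [OF c])
next
  fix x w assume x: "x < length a" and w: "layer_ideal c k x w"
  then show "layer_ideal c k (Suc x) (w - 1)"
    using small_chains_neighbours(1) [OF c, of "w - int k - 1" "Suc x"]
    by (simp add: layer_ideal_def algebra_simps)
next
  fix x w assume x: "x < length a" and w: "layer_ideal c k (Suc x) w"
  then show "layer_ideal c k x (w - 1)"
    using small_chains_neighbours(2) [OF c, of "w - int k - 1" "Suc x"]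
    by (simp add: layer_ideal_def algebra_simps)
qed

lemmas layers_of_chain =
  length_path_of [OF ideal_layer_ideal, folded layers_of_chain_def]
  below_path_of [OF ideal_layer_ideal, folded layers_of_chain_def]

text \<open>Layers lie above \<open>a\<close> because chains increase, and they decrease in
  \<open>k\<close> because a larger \<open>k\<close> looks at an earlier time.\<close>

lemma layers_of_chain_in_layers:
  assumes a: "dyck a" and c: "c \<in> small_chains (lift a)"
  shows "layers_of_chain (length a) c \<in> layers a"
proof -
  let ?m = "length a" and ?t = "layers_of_chain (length a) c"
  note len = layers_of_chain(1) [OF c] and bel = layers_of_chain(2) [OF c]
  have ge: "a \<preceq> ?t k" for k
  proof (rule below_le [OF below_self bel])
    fix x w assume x: "x \<le> length a" and w: "w \<le> height a x"
    have "w \<le> int x" using height_le_abscissa [OF x] w by simp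
    moreover have "height (c ! 0) (Suc x) \<le> height (c ! nat (w - int k - 1)) (Suc x)"
      using small_chains_mono [OF c, of 0 "nat (w - int k - 1)"] \<open>w \<le> int x\<close> x
      by (intro path_leD) (simp_all add: small_chains_0 [OF c])
    ultimately show "layer_ideal c k x w"
      using w height_lift(1) [OF x] by (simp add: layer_ideal_def small_chains_0 [OF c])
  qed (simp add: len)
  have anti: "?t (Suc k) \<preceq> ?t k" for k
  proof (rule below_le [OF bel bel])
    fix x w assume x: "x \<le> length (?t (Suc k))" and w: "layer_ideal c (Suc k) x w"
    have "height (c ! nat (w - int (Suc k) - 1)) (Suc x) \<le> height (c ! nat (w - int k - 1)) (Suc x)"
      using w x len small_chains_length [OF c]
      by (intro path_leD small_chains_mono [OF c]) (auto simp: layer_ideal_def)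
    then show "layer_ideal c k x w" using w by (simp add: layer_ideal_def)
  qed (simp add: len)
  have "height (?t 0) ?m = 0"
  proof (rule antisym)
    show "0 \<le> height (?t 0) ?m"
      using path_leD [OF ge, of ?m 0] a by (simp add: dyck_def)
    show "height (?t 0) ?m \<le> 0"
    proof (rule ccontr)
      let ?w = "height (?t 0) ?m"
      assume "\<not> ?w \<le> 0"
      moreover have "layer_ideal c 0 ?m ?w" using below_height [OF bel, of ?m 0] len by simp
      \<comment> \<open>One column before the end of the lifted path, time \<open>?w - 1\<close>
        allows height at most \<open>?w\<close>, but the ideal demands
        \<open>?w + 1\<close>.\<close>
      moreover have "height (c ! nat (?w - 1)) (Suc ?m) \<le> max (int (nat (?w - 1)) + 1) 1"
        if "?w \<le> int ?m"
        using small_chain_upper [of "Suc ?m" "\<lambda>i. c ! i" "nat (?w - 1)" "Suc ?m"] that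
          small_chains_0 [OF c] small_chains_step [OF c] dyck_lift [OF a] by simp
      ultimately show False by (auto simp: layer_ideal_def)
    qed
  qed
  moreover have "height (?t k) x = height a x" if x: "x \<le> ?m" and k: "height a x < int k" for k x
  proof (rule ccontr)
    assume ne: "height (?t k) x \<noteq> height a x"
    have par: "even (int x + (height a x + 2))" using height_parity [OF x] by presburger
    have "height a x < height (?t k) x" using path_leD [OF ge x, of k] ne by simp
    moreover have "height (?t k) x \<noteq> height a x + 1"
      using height_parity [OF x] height_parity [of x "?t k"] len x by auto
    ultimately have "height a x + 2 \<le> height (?t k) x" by linarith
    then have "layer_ideal c k x (height a x + 2)"
      using belowD [OF bel _ par] len x by simp
    \<comment> \<open>As \<open>height a x < k\<close>, the time for level
      \<open>height a x + 2\<close> clamps to 0, where \<open>lift a\<close> only reaches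
      \<open>height a x + 1\<close>.\<close>
    then show False
      using k height_lift(1) [OF x] by (simp add: layer_ideal_def small_chains_0 [OF c])
  qed
  ultimately show ?thesis using ge anti by (simp add: layers_def)
qed

text \<open>Raising the time lowers the layer index, and layers decrease in the index. At
  \<open>z = i + 2\<close> the point passes to the first alternative, where \<open>z <= x\<close>
  holds since heights never exceed abscissae.\<close>

lemma chain_ideal_mono:
  assumes t: "t \<in> layers a" and x: "x \<le> length a + 2"
    and R: "chain_ideal (length a) t i x z"
  shows "chain_ideal (length a) t (Suc i) x z"
proof -
  let ?h = "\<lambda>k. height (t k) (x - 1)"
  consider "z \<le> int i + 1" | "z = int i + 2" | "int i + 3 \<le> z" by linarith
  then show ?thesis
  proof cases
    case 1
    then show ?thesis using R by (auto simp: chain_ideal_def)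
  next
    case 2
    then have "x \<ge> 1" "x \<le> Suc (length a)" "z - 1 \<le> ?h (nat (z - 2 - int i))"
      using R by (auto simp: chain_ideal_def)
    moreover have "?h (nat (z - 2 - int i)) \<le> int (x - 1)"
      using calculation(2) layers_length [OF t] by (intro height_le_abscissa) simp
    ultimately show ?thesis using 2 by (auto simp: chain_ideal_def of_nat_diff)
  next
    case 3
    then have x: "x \<ge> 1" "x \<le> Suc (length a)" and z: "z - 1 \<le> ?h (nat (z - 2 - int i))"
      using R by (auto simp: chain_ideal_def)
    have "?h (nat (z - 2 - int i)) \<le> ?h (nat (z - 2 - int (Suc i)))"
      using x layers_length [OF t] by (intro path_leD layers_antimono [OF t]) auto
    then show ?thesis using 3 x z by (auto simp: chain_ideal_def)
  qed
qed

text \<open>Lowering time and level together keeps \<open>z - 2 - i\<close>, so both sides concern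
  the same layer \<open>Q\<close>, whose neighbouring heights differ by 1.\<close>

lemma chain_ideal_neighbours:
  assumes a: "dyck a" and t: "t \<in> layers a" and x: "x < length a + 2"
  shows "chain_ideal (length a) t (Suc i) x z \<Longrightarrow> chain_ideal (length a) t i (Suc x) (z - 1)"
    and "chain_ideal (length a) t (Suc i) (Suc x) z \<Longrightarrow> chain_ideal (length a) t i x (z - 1)"
proof -
  let ?m = "length a"
  note D = dyck_layers [OF a t] and len = layers_length [OF t]
  have idx: "z - 1 - 2 - int i = z - 2 - int (Suc i)" by simp
  {
    assume R: "chain_ideal ?m t (Suc i) x z"
    show "chain_ideal ?m t i (Suc x) (z - 1)"
    proof (cases "z \<le> int i + 2")
      case True
      then show ?thesis using R by (auto simp: chain_ideal_def)
    next
      case False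
      define Q where "Q = t (nat (z - 2 - int (Suc i)))"
      have x1: "1 \<le> x" "x \<le> Suc ?m" and z: "z - 1 \<le> height Q (x - 1)"
        using R False by (auto simp: chain_ideal_def Q_def)
      have Q: "dyck Q" "length Q = ?m" using D len by (auto simp: Q_def)
      \<comment> \<open>At \<open>x = Suc ?m\<close> the layer would be at its end, of height 0,
        while \<open>z - 1\<close> is positive here.\<close>
      have "x \<noteq> Suc ?m" using z Q False by (auto simp: dyck_def)
      then have "x - 1 < length Q" using x1 Q by linarith
      from height_Suc_bounds(2) [OF this] have "z - 2 \<le> height Q x"
        using x1 z by simp
      then show ?thesis
        using x1 \<open>x \<noteq> Suc ?m\<close> False unfolding chain_ideal_def idx Q_def by auto
    qed
  next
    assume R: "chain_ideal ?m t (Suc i) (Suc x) z"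
    show "chain_ideal ?m t i x (z - 1)"
    proof (cases "z \<le> int i + 2")
      case True
      then show ?thesis using R by (auto simp: chain_ideal_def)
    next
      case False
      define Q where "Q = t (nat (z - 2 - int (Suc i)))"
      have x1: "x \<le> ?m" and z: "z - 1 \<le> height Q x"
        using R False by (auto simp: chain_ideal_def Q_def)
      have Q: "dyck Q" "length Q = ?m" using D len by (auto simp: Q_def)
      have "x \<noteq> 0" using z False by (intro notI) simp
      then have "x - 1 < length Q" using x1 Q by linarith
      from height_Suc_bounds(1) [OF this] have "z - 2 \<le> height Q (x - 1)"
        using \<open>x \<noteq> 0\<close> z by simp
      then show ?thesis
        using x1 \<open>x \<noteq> 0\<close> False unfolding chain_ideal_def idx Q_def by auto
    qed
  }
qed

text \<open>\<open>chain_ideal_mono\<close> raises the time to \<open>Suc i\<close>;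
  \<open>chain_ideal_neighbours\<close> returns to time \<open>i\<close>, one level lower in the
  next column.\<close>

lemma ideal_chain_ideal:
  assumes a: "dyck a" and t: "t \<in> layers a"
  shows "ideal (length a + 2) (chain_ideal (length a) t i)"
  unfolding ideal_def
  using chain_ideal_mono [OF t] chain_ideal_neighbours [OF a t]
  by (auto simp: chain_ideal_def [of _ _ _ 0])

lemma chain_of_layers_nth:
  assumes a: "dyck a" and t: "t \<in> layers a" and i: "i < length a + 2"
  shows "length (chain_of_layers (length a) t ! i) = length a + 2"
    and "below (chain_of_layers (length a) t ! i) (chain_ideal (length a) t i)"
  using length_path_of [OF ideal_chain_ideal [OF a t]] below_path_of [OF ideal_chain_ideal [OF a t]] i
  by (simp_all add: chain_of_layers_def del: upt_Suc)

text \<open>Above level 1 the layer of index \<open>z - 2\<close> is read at level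
  \<open>z - 1\<close>, where \<open>layers_low\<close> identifies it with \<open>a\<close>. In the
  last column parity rules out \<open>z = 1\<close>.\<close>

lemma chain_ideal_0:
  assumes a: "dyck a" and t: "t \<in> layers a" and x: "x \<le> length a + 2" and par: "even (int x + z)"
  shows "chain_ideal (length a) t 0 x z \<longleftrightarrow> z \<le> height (lift a) x"
proof -
  let ?m = "length a"
  consider "x = 0" | y where "x = Suc y" "y \<le> ?m" | "x = ?m + 2"
    using x by (cases x) (auto, linarith)
  then show ?thesis
  proof cases
    case 1
    then show ?thesis by (auto simp: chain_ideal_def)
  next
    case (2 y)
    show ?thesis
    proof (cases "z \<le> 1")
      case True
      then show ?thesis
        using 2 height_lift(1) [of y a] dyck_height_nonneg [OF a, of y] by (auto simp: chain_ideal_def)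
    next
      case False
      have "even (int y + (z - 1))" using par 2 by auto
      then have "z - 1 \<le> height (t (nat (z - 2))) y \<longleftrightarrow> z - 1 \<le> height a y"
        using False 2 by (intro layers_low [OF t]) auto
      then show ?thesis using False 2 height_lift(1) [of y a] by (auto simp: chain_ideal_def)
    qed
  next
    case 3
    have "even z" using par 3 even_length_dyck [OF a] by simp
    then have "z \<noteq> 1" by auto
    moreover have "height (lift a) x = 0" using 3 height_lift(2) [of a] a by (simp add: dyck_def)
    ultimately show ?thesis using 3 by (auto simp: chain_ideal_def)
  qed
qed

lemma chain_of_layers_in_small_chains:
  assumes a: "dyck a" and t: "t \<in> layers a"
  shows "chain_of_layers (length a) t \<in> small_chains (lift a)"
proof -
  let ?m = "length a" and ?c = "chain_of_layers (length a) t"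
  note nth = chain_of_layers_nth [OF a t]
  have "?c ! 0 = lift a"
    by (rule below_unique [OF nth(2) below_self]) (simp_all add: nth(1) chain_ideal_0 [OF a t])
  \<comment> \<open>At time \<open>Suc ?m\<close> the second alternative would need a layer height
    above its abscissa.\<close>
  moreover have "?c ! Suc ?m = top_path (?m + 2)"
    by (rule below_unique [OF nth(2) below_self])
      (auto simp: nth(1) chain_ideal_def layers_length [OF t]
        dest!: order_trans [OF _ height_le_abscissa])
  moreover have "small_step (?c ! i) (?c ! Suc i)" if i: "i < Suc ?m" for i
  proof -
    let ?P = "?c ! i" and ?Q = "?c ! Suc i"
    have P: "length ?P = ?m + 2" "below ?P (chain_ideal ?m t i)"
      and Q: "length ?Q = ?m + 2" "below ?Q (chain_ideal ?m t (Suc i))"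
      using nth [of i] nth [of "Suc i"] i by simp_all
    have "?P \<preceq> ?Q"
      using P Q by (intro below_le [OF P(2) Q(2)]) (simp_all add: chain_ideal_mono [OF t])
    moreover have "height ?Q x \<le> height ?P (Suc x) + 1 \<and> height ?Q (Suc x) \<le> height ?P x + 1"
      if x: "x < ?m + 2" for x
    proof
      have "even (int (Suc x) + (height ?Q x - 1))"
        using height_parity [of x ?Q] Q x by simp
      moreover have "chain_ideal ?m t i (Suc x) (height ?Q x - 1)"
        using below_height [OF Q(2)] Q x by (intro chain_ideal_neighbours [OF a t x]) simp
      ultimately show "height ?Q x \<le> height ?P (Suc x) + 1"
        using belowD [OF P(2), of "Suc x" "height ?Q x - 1"] P x by simp
      have "even (int x + (height ?Q (Suc x) - 1))"
        using height_parity [of "Suc x" ?Q] Q x by auto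
      moreover have "chain_ideal ?m t i x (height ?Q (Suc x) - 1)"
        using below_height [OF Q(2)] Q x by (intro chain_ideal_neighbours [OF a t x]) simp
      ultimately show "height ?Q (Suc x) \<le> height ?P x + 1"
        using belowD [OF P(2), of x "height ?Q (Suc x) - 1"] P x by simp
    qed
    ultimately show ?thesis using P by (simp add: small_step_def)
  qed
  ultimately show ?thesis by (simp add: small_chains_def chain_of_layers_def del: upt_Suc)
qed

text \<open>Up to level \<open>i + 1\<close> the path is full by \<open>small_chain_lower\<close>.
  Above, layer \<open>z - 2 - i\<close> at level \<open>z - 1\<close> consults time \<open>i\<close>
  again; in the last column \<open>small_chain_upper\<close> leaves nothing.\<close>

lemma chain_of_layers_of_chain:
  assumes a: "dyck a" and c: "c \<in> small_chains (lift a)"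
  shows "chain_of_layers (length a) (layers_of_chain (length a) c) = c"
proof (rule nth_equalityI)
  let ?m = "length a" and ?t = "layers_of_chain (length a) c"
  note t = layers_of_chain_in_layers [OF a c]
  show "length (chain_of_layers ?m ?t) = length c"
    by (simp add: chain_of_layers_def small_chains_len [OF c])
  fix i assume "i < length (chain_of_layers ?m ?t)"
  then have i: "i < ?m + 2" by (simp add: chain_of_layers_def)
  note nth = chain_of_layers_nth [OF a t i]
  have lenc: "length (c ! i) = ?m + 2" using small_chains_length [OF c] i by simp
  show "chain_of_layers ?m ?t ! i = c ! i"
  proof (rule below_unique [OF nth(2) below_self])
    fix x z assume "x \<le> length (chain_of_layers ?m ?t ! i)" and par: "even (int x + z)"
    then have x: "x \<le> ?m + 2" using nth by simp
    show "chain_ideal ?m ?t i x z \<longleftrightarrow> z \<le> height (c ! i) x"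
    proof (cases "z \<le> int i + 1")
      case True
      have "z \<le> height (c ! i) x" if "z \<le> int x"
        using small_chain_lower [of "Suc ?m" "\<lambda>i. c ! i" i x z] small_chains_step [OF c]
          small_chains_top [OF c] i x par that True by simp
      then show ?thesis
        using True height_le_abscissa [of x "c ! i"] lenc x by (auto simp: chain_ideal_def)
    next
      case False
      consider "x = 0" | y where "x = Suc y" "y \<le> ?m" | "x = ?m + 2"
        using x by (cases x) (auto, linarith)
      then show ?thesis
      proof cases
        case 1
        then show ?thesis using False by (auto simp: chain_ideal_def)
      next
        case (2 y)
        have "even (int y + (z - 1))" using par 2 by auto
        then have "z - 1 \<le> height (?t (nat (z - 2 - int i))) y \<longleftrightarrow>
            layer_ideal c (nat (z - 2 - int i)) y (z - 1)"
          using layers_of_chain [OF c] 2 by (intro belowD) auto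
        moreover have "z - 1 - int (nat (z - 2 - int i)) - 1 = int i" using False by simp
        ultimately show ?thesis
          using False 2 height_le_abscissa [of x "c ! i"] lenc x
          by (auto simp: chain_ideal_def layer_ideal_def)
      next
        case 3
        have "height (c ! i) x \<le> int i + 1"
          using small_chain_upper [of "Suc ?m" "\<lambda>i. c ! i" i x] small_chains_step [OF c]
            small_chains_0 [OF c] dyck_lift [OF a] i 3 by simp
        then show ?thesis using False 3 by (auto simp: chain_ideal_def)
      qed
    qed
  qed (simp add: nth lenc)
qed

text \<open>For \<open>w > k\<close> the index arithmetic inverts exactly. For
  \<open>0 < w <= k\<close> the time clamps to 0 and layer \<open>w - 1\<close> is consulted instead
  of \<open>k\<close>; by \<open>layers_low\<close> both agree with \<open>a\<close> at level
  \<open>w\<close>.\<close>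

lemma layers_of_chain_of_layers:
  assumes a: "dyck a" and t: "t \<in> layers a"
  shows "layers_of_chain (length a) (chain_of_layers (length a) t) = t"
proof
  fix k
  let ?m = "length a" and ?c = "chain_of_layers (length a) t"
  note c = chain_of_layers_in_small_chains [OF a t]
  show "layers_of_chain ?m ?c k = t k"
  proof (rule below_unique [OF layers_of_chain(2) [OF c] below_self])
    fix x w assume "x \<le> length (layers_of_chain ?m ?c k)" and par: "even (int x + w)"
    then have x: "x \<le> ?m" by (simp add: layers_of_chain(1) [OF c])
    note le = height_le_abscissa [of x "t k", unfolded layers_length [OF t], OF x]
    let ?i = "nat (w - int k - 1)"
    have *: "w + 1 \<le> height (?c ! ?i) (Suc x) \<longleftrightarrow> chain_ideal ?m t ?i (Suc x) (w + 1)"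
      if "w \<le> int x"
      using chain_of_layers_nth [OF a t, of ?i] that x par by (intro belowD) auto
    show "layer_ideal ?c k x w \<longleftrightarrow> w \<le> height (t k) x"
    proof (cases "w \<le> int k")
      case True
      show ?thesis
      proof (cases "w \<le> 0")
        case True
        then show ?thesis
          using * dyck_height_nonneg [OF dyck_layers [OF a t], of x k] layers_length [OF t] x
          by (auto simp: layer_ideal_def chain_ideal_def)
      next
        case False
        have "w \<le> height (t (nat (w - 1))) x \<longleftrightarrow> w \<le> height a x"
          using False by (intro layers_low [OF t x par]) simp
        moreover have "w \<le> height (t k) x \<longleftrightarrow> w \<le> height a x"
          using True by (intro layers_low [OF t x par]) simp
        ultimately show ?thesis
          using * le False True x by (auto simp: layer_ideal_def chain_ideal_def)
      qed
    next
      case False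
      then have "nat (w - 1 - int ?i) = k" by simp
      then show ?thesis using * le False x by (auto simp: layer_ideal_def chain_ideal_def)
    qed
  qed (simp add: layers_of_chain(1) [OF c] layers_length [OF t])
qed

lemma card_small_chains_lift:
  assumes "dyck a"
  shows "card (small_chains (lift a)) = card (layers a)"
proof -
  have "bij_betw (layers_of_chain (length a)) (small_chains (lift a)) (layers a)"
    using assms
    by (intro bij_betw_byWitness [where f' = "chain_of_layers (length a)"])
      (auto simp: chain_of_layers_of_chain layers_of_chain_of_layers
        layers_of_chain_in_layers chain_of_layers_in_small_chains)
  then show ?thesis by (rule bij_betw_same_card)
qed

section \<open>Multichains of type v\<close>

text \<open>If some point of height at most \<open>H\<close> moved, then so would a lowest one; were it not a valley,
  it would have a lower neighbour, which stays and pins it down.\<close>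

lemma low_points_fixed:
  assumes le: "P \<preceq> Q" and P: "dyck P" and Q: "dyck Q"
    and stay: "\<And>x. x \<in> valleys P \<Longrightarrow> height P x \<le> H \<Longrightarrow> height Q x = height P x"
    and "x \<le> length P" "height P x \<le> H"
  shows "height Q x = height P x"
  using assms(5,6)
proof (induction "nat (height P x)" arbitrary: x rule: less_induct)
  case less
  note len = path_le_length [OF le]
  have IH: "height Q y = height P y" if "y \<le> length P" "height P y = height P x - 1" for y
    using that less.prems dyck_height_nonneg [OF P that(1)] by (intro less.hyps) auto
  have ge: "height P x \<le> height Q x" using path_leD [OF le less.prems(1)] .
  consider "x = 0" | "x = length P" | "x \<in> valleys P" | "0 < x" "height P (x - 1) = height P x - 1"
    | "x < length P" "height P (Suc x) = height P x - 1"
  proof -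
    have "height P x = height P (x - 1) + 1 \<or> height P x = height P (x - 1) - 1" if "0 < x"
      using that less.prems(1) height_Suc_cases [of "x - 1" P] by (metis Suc_pred' Suc_le_lessD)
    moreover have "height P (Suc x) = height P x + 1 \<or> height P (Suc x) = height P x - 1"
      if "x < length P"
      using that height_Suc_cases [of x P] by metis
    ultimately show ?thesis
      using that less.prems(1) by (fastforce simp: valleys_iff_height)
  qed
  then show ?case
  proof cases
    case 2
    then show ?thesis using P Q len by (simp add: dyck_def)
  next
    case 3
    then show ?thesis using stay less.prems by simp
  next
    case 4
    then have "height Q (x - 1) = height P x - 1" using IH [of "x - 1"] less.prems by simp
    then show ?thesis
      using height_Suc_bounds(1) [of "x - 1" Q] 4 less.prems len ge by simp
  next
    case 5
    then have "height Q (Suc x) = height P x - 1" using IH [of "Suc x"] by simp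
    then show ?thesis using height_Suc_bounds(2) [of x Q] 5 len ge by simp
  qed simp
qed

text \<open>Preserved valleys pin down all low points by \<open>low_points_fixed\<close>.
  Conversely, a valley is recognised by its neighbours: those one lower are fixed too, and those one
  higher cannot drop because \<open>P\<close> lies below \<open>Q\<close>.\<close>

lemma low_valleys_eq_iff:
  assumes le: "P \<preceq> Q" and P: "dyck P" and Q: "dyck Q"
  shows "{p \<in> valley_points Q. snd p \<le> H} = {p \<in> valley_points P. snd p \<le> H} \<longleftrightarrow>
    (\<forall>x\<le>length P. height P x \<le> H \<longrightarrow> height Q x = height P x)"
proof
  assume eq: "{p \<in> valley_points Q. snd p \<le> H} = {p \<in> valley_points P. snd p \<le> H}"
  have "height Q x = height P x" if "x \<in> valleys P" "height P x \<le> H" for x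
  proof -
    have "(x, height P x) \<in> {p \<in> valley_points P. snd p \<le> H}"
      using that by (auto simp: valley_points_def)
    then show ?thesis unfolding eq [symmetric] by (auto simp: valley_points_def)
  qed
  then show "\<forall>x\<le>length P. height P x \<le> H \<longrightarrow> height Q x = height P x"
    using low_points_fixed [OF le P Q] by blast
next
  note len = path_le_length [OF le]
  assume stay: "\<forall>x\<le>length P. height P x \<le> H \<longrightarrow> height Q x = height P x"
  have nb: "height Q y = h + 1 \<longleftrightarrow> height P y = h + 1"
    if "y \<le> length P" "h \<le> H" "height P y = h + 1 \<or> height P y = h - 1"
      "height Q y = h + 1 \<or> height Q y = h - 1" for y h
    using that stay [rule_format, of y] path_leD [OF le, of y] by auto
  have val: "x \<in> valleys Q \<longleftrightarrow> x \<in> valleys P"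
    if x: "x \<le> length P" and h: "height P x \<le> H" for x
  proof -
    have hQ: "height Q x = height P x" using stay x h by blast
    have "height Q (x - 1) = height P x + 1 \<longleftrightarrow> height P (x - 1) = height P x + 1" if "1 \<le> x"
    proof (rule nb)
      have *: "x - 1 < length P" "Suc (x - 1) = x" using that x by auto
      show "height P (x - 1) = height P x + 1 \<or> height P (x - 1) = height P x - 1"
        using height_Suc_bounds [of "x - 1" P] height_Suc_neq [of "x - 1" P] * by auto
      show "height Q (x - 1) = height P x + 1 \<or> height Q (x - 1) = height P x - 1"
        using height_Suc_bounds [of "x - 1" Q] height_Suc_neq [of "x - 1" Q] * len hQ by auto
    qed (use x h in auto)
    moreover have "height Q (Suc x) = height P x + 1 \<longleftrightarrow> height P (Suc x) = height P x + 1"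
      if "x \<noteq> length P"
    proof (rule nb)
      have *: "x < length P" using that x by auto
      show "height P (Suc x) = height P x + 1 \<or> height P (Suc x) = height P x - 1"
        using height_Suc_bounds [OF *] height_Suc_neq [OF *] by auto
      show "height Q (Suc x) = height P x + 1 \<or> height Q (Suc x) = height P x - 1"
        using height_Suc_bounds [of x Q] height_Suc_neq [of x Q] * len hQ by auto
    qed (use x h that in auto)
    ultimately show ?thesis using hQ len by (auto simp: valleys_iff_height)
  qed
  \<comment> \<open>A point low in \<open>Q\<close> is also low in \<open>P\<close>, so
    \<open>val\<close> serves both directions.\<close>
  have iff: "x \<in> valleys Q \<and> height Q x = y \<and> y \<le> H \<longleftrightarrow> x \<in> valleys P \<and> height P x = y \<and> y \<le> H" for x y
  proof (cases "x \<le> length P")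
    case True
    then show ?thesis
      using val [of x] stay [rule_format, of x] path_leD [OF le, of x] by auto
  qed (auto simp: valleys_iff_height len)
  have "(x, y) \<in> {p \<in> valley_points Q. snd p \<le> H} \<longleftrightarrow> (x, y) \<in> {p \<in> valley_points P. snd p \<le> H}" for x y
    using iff [of x y] by (auto simp: valley_points_def)
  then show "{p \<in> valley_points Q. snd p \<le> H} = {p \<in> valley_points P. snd p \<le> H}" by fast
qed

lemma height_le_highest_valley: "x \<in> valleys P \<Longrightarrow> height P x \<le> int (highest_valley P)"
proof -
  assume x: "x \<in> valleys P"
  have "finite (valleys P)" by (rule finite_subset [of _ "{..length P}"]) (auto simp: valleys_def)
  then have "height P x \<le> Max (height P ` valleys P)" using x by simp
  then show ?thesis by (simp add: highest_valley_def)
qed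

text \<open>From this index on all valleys of \<open>a\<close> are fixed, and with them the whole
  path; this is why a finite multichain records the sequence.\<close>

lemma layers_above_highest_valley:
  assumes a: "dyck a" and t: "t \<in> layers a" and k: "highest_valley a < k"
  shows "t k = a"
proof (rule path_eqI)
  fix x assume "x \<le> length (t k)"
  then have x: "x \<le> length a" by (simp add: layers_length [OF t])
  show "height (t k) x = height a x"
  \<comment> \<open>\<open>order_refl\<close> takes the height of \<open>a\<close> at
    \<open>x\<close> itself as the bound \<open>H\<close>.\<close>
  proof (rule low_points_fixed [OF layers_ge [OF t] a dyck_layers [OF a t] _ x order_refl])
    fix y assume y: "y \<in> valleys a"
    then have "y \<le> length a" by (simp add: valleys_iff_height)
    then show "height (t k) y = height a y"
      using layers_fixed [OF t, of y k] height_le_highest_valley [OF y] k by simp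
  qed
qed (simp add: layers_length [OF t])

text \<open>The last path is left free; it becomes the summation index \<open>s\<close>.\<close>

definition v_chains :: "path \<Rightarrow> path list set" where
  "v_chains a = {c. type_v c \<and> c ! 0 = a}"

text \<open>\<open>low_valleys_eq_iff\<close> turns valleys into points, and height at most
  \<open>h - (j + 1)\<close> into height less than \<open>h - j\<close>, the form used for
  layers.\<close>

lemma v_chains_iff:
  "c \<in> v_chains a \<longleftrightarrow> c ! 0 = a \<and> length c = Suc (highest_valley a) \<and> (\<forall>\<sigma>\<in>set c. dyck \<sigma>) \<and>
     (\<forall>j<highest_valley a. c ! j \<preceq> c ! Suc j \<and>
        (\<forall>x\<le>length (c ! j). height (c ! j) x < int (highest_valley a) - int j \<longrightarrow>
           height (c ! Suc j) x = height (c ! j) x))"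
proof -
  let ?h = "highest_valley a"
  have shift: "(\<forall>j\<in>{1..?h}. S (j - 1) j) \<longleftrightarrow> (\<forall>j<?h. S j (Suc j))" for S
    unfolding image_Suc_lessThan [symmetric] by auto
  have "type_v c \<longleftrightarrow> length c = Suc ?h \<and> (\<forall>\<sigma>\<in>set c. dyck \<sigma>) \<and>
     (\<forall>j<?h. c ! j \<preceq> c ! Suc j \<and>
        {p \<in> valley_points (c ! Suc j). snd p \<le> int ?h - int (Suc j)} =
        {p \<in> valley_points (c ! j). snd p \<le> int ?h - int (Suc j)})" if "c ! 0 = a"
    unfolding type_v_def Let_def that
      shift [of "\<lambda>i j. c ! i \<preceq> c ! j \<and>
        {p \<in> valley_points (c ! j). snd p \<le> int ?h - int j} =
        {p \<in> valley_points (c ! i). snd p \<le> int ?h - int j}"] ..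
  moreover have "{p \<in> valley_points (c ! Suc j). snd p \<le> int ?h - int (Suc j)} =
        {p \<in> valley_points (c ! j). snd p \<le> int ?h - int (Suc j)} \<longleftrightarrow>
        (\<forall>x\<le>length (c ! j). height (c ! j) x < int ?h - int j \<longrightarrow>
           height (c ! Suc j) x = height (c ! j) x)"
    if "j < ?h" "c ! j \<preceq> c ! Suc j" "length c = Suc ?h" "\<forall>\<sigma>\<in>set c. dyck \<sigma>" for j
  proof -
    have "dyck (c ! j)" "dyck (c ! Suc j)" using that by (simp_all add: nth_mem)
    from low_valleys_eq_iff [OF that(2) this, of "int ?h - int (Suc j)"]
    moreover have "y \<le> int ?h - int (Suc j) \<longleftrightarrow> y < int ?h - int j" for y :: int by linarith
    ultimately show ?thesis by (simp only:)
  qed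
  ultimately show ?thesis unfolding v_chains_def mem_Collect_eq by blast
qed

lemma v_chainsD:
  assumes "c \<in> v_chains a"
  shows v_chains_0: "c ! 0 = a" and v_chains_len: "length c = Suc (highest_valley a)"
    and v_chains_dyck: "j \<le> highest_valley a \<Longrightarrow> dyck (c ! j)"
    and v_chains_le: "j < highest_valley a \<Longrightarrow> c ! j \<preceq> c ! Suc j"
  using assms by (auto simp: v_chains_iff)

text \<open>Composing the steps compares each path with \<open>a\<close> itself; the bound is that
  of layer \<open>h + 1 - j\<close>, where \<open>h\<close> is
  \<open>highest_valley a\<close>.\<close>

lemma v_chains_above:
  assumes c: "c \<in> v_chains a" and "j \<le> highest_valley a"
  shows "a \<preceq> c ! j \<and> (\<forall>x\<le>length a. height a x < int (highest_valley a) + 1 - int j \<longrightarrow>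
    height (c ! j) x = height a x)"
  using assms(2)
proof (induction j)
  case 0
  then show ?case by (simp add: v_chains_0 [OF c])
next
  case (Suc j)
  then have IH: "a \<preceq> c ! j" "\<And>x. x \<le> length a \<Longrightarrow> height a x < int (highest_valley a) + 1 - int j \<Longrightarrow>
      height (c ! j) x = height a x" by auto
  have "c ! j \<preceq> c ! Suc j" using v_chains_le [OF c] Suc.prems by simp
  moreover have "height (c ! Suc j) x = height (c ! j) x"
    if "x \<le> length a" "height (c ! j) x < int (highest_valley a) - int j" for x
    using c that path_le_length [OF IH(1)] Suc.prems by (auto simp: v_chains_iff)
  ultimately show ?case using IH path_le_trans by auto
qed

lemma finite_v_chains: "finite (v_chains a)"
proof (rule finite_subset)
  show "v_chains a \<subseteq> {c. set c \<subseteq> {P. length P = length a} \<and> length c = Suc (highest_valley a)}"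
  proof safe
    fix c P assume c: "c \<in> v_chains a" and "P \<in> set c"
    then obtain j where "j \<le> highest_valley a" "P = c ! j"
      using v_chains_len [OF c] by (auto simp: in_set_conv_nth less_Suc_eq_le)
    then show "length P = length a" 
      using v_chains_above [OF c, of j] path_le_length [of a P] by simp
  qed (rule v_chains_len)
  show "finite {c. set c \<subseteq> {P :: path. length P = length a} \<and> length c = Suc (highest_valley a)}"
    by (rule finite_lists_length_eq [OF finite_paths])
qed

section \<open>Counting layers through multichains and intervals\<close>

abbreviation pyramid :: "nat \<Rightarrow> path" where
  "pyramid n \<equiv> replicate (n div 2) Up @ replicate (n div 2) Down"

lemma height_pyramid:
  assumes "even n" "x \<le> n"
  shows "height (pyramid n) x = min (int x) (int n - int x)"
proof -
  obtain k where "n = 2 * k" using assms(1) by (elim evenE)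
  then show ?thesis using assms(2) by (auto simp: height_def sum_list_replicate min_def)
qed

text \<open>The pyramid is the highest Dyck path of its length, and a path above a Dyck path that
  ends at height 0 is Dyck.\<close>

lemma path_interval_pyramid:
  assumes s: "dyck s"
  shows "R \<in> path_interval s (pyramid (length s)) \<longleftrightarrow> s \<preceq> R \<and> height R (length s) = 0"
proof -
  let ?n = "length s"
  note ev = even_length_dyck [OF s]
  have "R \<preceq> pyramid ?n \<longleftrightarrow> height R ?n = 0" if le: "s \<preceq> R"
  proof
    assume "R \<preceq> pyramid ?n"
    then have "height R ?n \<le> 0"
      using path_leD [of R "pyramid ?n" ?n] height_pyramid [OF ev, of ?n] path_le_length [OF le] by simp
    then show "height R ?n = 0" using path_leD [OF le, of ?n] s by (simp add: dyck_def)
  next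
    note len = path_le_length [OF le]
    assume "height R ?n = 0"
    then have "dyck R"
      using path_leD [OF le] s len by (fastforce simp: dyck_def intro: order_trans)
    then show "R \<preceq> pyramid ?n"
      using height_pyramid [OF ev] dyck_height_le [of R] height_le_abscissa [of _ R] len ev
      by (auto simp: path_le_def)
  qed
  then show ?thesis by (auto simp: path_interval_def)
qed

text \<open>The second component plays the part of layer 0.\<close>

definition v_flags :: "path \<Rightarrow> (path list \<times> path) set" where
  "v_flags a = (SIGMA c:v_chains a. path_interval (c ! highest_valley a) (pyramid (length a)))"

lemma v_flags_iff:
  "(c, R) \<in> v_flags a \<longleftrightarrow>
     c \<in> v_chains a \<and> c ! highest_valley a \<preceq> R \<and> height R (length a) = 0"
proof -
  have "path_interval (c ! highest_valley a) (pyramid (length a)) =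
      {R. c ! highest_valley a \<preceq> R \<and> height R (length a) = 0}" if c: "c \<in> v_chains a"
    using path_interval_pyramid [OF v_chains_dyck [OF c order_refl]]
      path_le_length [OF conjunct1 [OF v_chains_above [OF c order_refl]]] by auto
  then show ?thesis by (auto simp: v_flags_def)
qed

text \<open>Layers \<open>h + 1\<close> down to 1 form the multichain in this order, layer 0 is the
  additional path, and all later layers equal \<open>a\<close>.\<close>

lemma card_layers:
  assumes a: "dyck a"
  shows "card (layers a) = card (v_flags a)"
proof -
  define h where "h = highest_valley a"
  define F where "F t = (map (\<lambda>j. t (Suc h - j)) [0..<Suc h], t 0)" for t :: "nat \<Rightarrow> path"
  \<comment> \<open>For \<open>k > Suc h\<close> truncated subtraction yields entry 0, which is
    \<open>a\<close>.\<close>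
  define G where "G p k = (if k = 0 then snd p else fst p ! (Suc h - k))"
    for p :: "path list \<times> path" and k
  have F: "F t \<in> v_flags a" if t: "t \<in> layers a" for t
  proof -
    let ?c = "fst (F t)"
    have nth: "?c ! j = t (Suc h - j)" if "j \<le> h" for j
      using that by (simp add: F_def del: upt_Suc)
    have "?c \<in> v_chains a"
      unfolding v_chains_iff h_def [symmetric]
    proof (intro conjI allI impI)
      show "?c ! 0 = a" using layers_above_highest_valley [OF a t, of "Suc h"] nth [of 0] by (simp add: h_def)
      show "length ?c = Suc h" by (simp add: F_def)
      show "\<forall>\<sigma>\<in>set ?c. dyck \<sigma>" using dyck_layers [OF a t] by (auto simp: F_def)
      fix j assume j: "j < h"
      show "?c ! j \<preceq> ?c ! Suc j" using j layers_antimono [OF t] by (simp add: nth)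
      fix x assume "x \<le> length (?c ! j)" and lt: "height (?c ! j) x < int h - int j"
      then have x: "x \<le> length a" using j layers_length [OF t] by (simp add: nth)
      \<comment> \<open>A point low in this entry is low in \<open>a\<close>, so this entry and the
        next both keep its height in \<open>a\<close>.\<close>
      have "height a x \<le> height (?c ! j) x" using path_leD [OF layers_ge [OF t] x] j by (simp add: nth)
      then show "height (?c ! Suc j) x = height (?c ! j) x"
        using lt j layers_fixed [OF t x] by (simp add: nth of_nat_diff)
    qed
    then have "(?c, t 0) \<in> v_flags a"
      using nth [of h] t by (simp add: v_flags_iff layers_def h_def [symmetric])
    then show ?thesis by (simp add: F_def)
  qed
  have G: "G p \<in> layers a" if "p \<in> v_flags a" for p
  proof -
    obtain c R where p: "p = (c, R)" by (cases p)
    with that have c: "c \<in> v_chains a" and R: "c ! h \<preceq> R" "height R (length a) = 0"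
      by (auto simp: v_flags_iff h_def)
    note above = v_chains_above [OF c, folded h_def]
    have "a \<preceq> G p k" for k
      using above [of "Suc h - k"] above [of h] R path_le_trans by (auto simp: G_def p)
    moreover have "G p (Suc k) \<preceq> G p k" for k
    proof -
      consider "k = 0" | "0 < k" "k \<le> h" | "h < k" by linarith
      then show ?thesis
      proof cases
        case 2
        then show ?thesis
          using v_chains_le [OF c, of "h - k"] by (simp add: G_def p h_def Suc_diff_le)
      qed (use R in \<open>auto simp: G_def p\<close>)
    qed
    moreover have "height (G p k) x = height a x" if "x \<le> length a" "height a x < int k" for k x
    proof -
      have "k \<noteq> 0" using that dyck_height_nonneg [OF a, of x] by (intro notI) simp
      then show ?thesis
        using above [of "Suc h - k"] that v_chains_0 [OF c] by (cases "k \<le> Suc h") (auto simp: G_def p of_nat_diff)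
    qed
    ultimately show ?thesis using R by (simp add: layers_def G_def p)
  qed
  have GF: "G (F t) = t" if t: "t \<in> layers a" for t
  proof
    fix k
    have "t (Suc h) = t k" if "Suc h \<le> k"
      using that layers_above_highest_valley [OF a t] by (simp add: h_def)
    then show "G (F t) k = t k"
      by (cases "k \<le> Suc h") (auto simp: G_def F_def simp del: upt_Suc)
  qed
  have FG: "F (G p) = p" if "p \<in> v_flags a" for p
  proof -
    obtain c R where p: "p = (c, R)" by (cases p)
    have "length c = Suc h" using that v_chains_len by (auto simp: v_flags_iff p h_def)
    then have "map (\<lambda>j. G p (Suc h - j)) [0..<Suc h] = c"
      by (intro nth_equalityI) (auto simp: G_def p simp del: upt_Suc)
    then show ?thesis by (simp add: F_def p) (simp add: G_def)
  qed
  have "bij_betw F (layers a) (v_flags a)"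
    using F G GF FG by (intro bij_betw_byWitness [where f' = G]) auto
  then show ?thesis by (rule bij_betw_same_card)
qed

text \<open>Flags are grouped by the last path \<open>s\<close> of the multichain; within a group
  the factor \<open>upper_count s\<close> is constant.\<close>

lemma card_v_flags:
  assumes a: "dyck a" "a \<noteq> []"
  shows "card (v_flags a) =
    (\<Sum>s | dyck s \<and> length s = length a \<and> a \<preceq> s. v_count a s * upper_count s)"
proof -
  let ?h = "highest_valley a" and ?S = "{s. dyck s \<and> length s = length a \<and> a \<preceq> s}"
  have last: "c ! ?h \<in> ?S" if "c \<in> v_chains a" for c
    using v_chains_above [OF that order_refl] v_chains_dyck [OF that order_refl]
      path_le_length [of a "c ! ?h"] by simp
  have finI: "finite (path_interval s (pyramid (length a)))" for s
    by (rule finite_subset [OF _ finite_paths [of "length (pyramid (length a))"]])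
      (auto simp: path_interval_def path_le_def)
  have finS: "finite ?S" by (rule finite_subset [OF _ finite_paths [of "length a"]]) auto
  have "card (v_flags a) = (\<Sum>c\<in>v_chains a. card (path_interval (c ! ?h) (pyramid (length a))))"
    unfolding v_flags_def by (rule card_SigmaI) (auto simp: finite_v_chains finI)
  also have "\<dots> = (\<Sum>c\<in>v_chains a. upper_count (c ! ?h))"
    using last by (intro sum.cong) (auto simp: upper_count_def)
  also have "\<dots> = (\<Sum>s\<in>?S. \<Sum>c\<in>{c \<in> v_chains a. c ! ?h = s}. upper_count (c ! ?h))"
    using last by (intro sum.group [symmetric] finite_v_chains finS) auto
  also have "\<dots> = (\<Sum>s\<in>?S. v_count a s * upper_count s)"
    using a(2) by (intro sum.cong) (auto simp: v_count_def v_chains_def conj_assoc)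
  finally show ?thesis .
qed

theorem proposition14:
  fixes a :: path
  assumes "dyck a"
  shows "small_chain_count (Up # a @ [Down]) =
    (\<Sum>s | dyck s \<and> length s = length a \<and> a \<preceq> s. v_count a s * upper_count s)"
proof -
  have 1: "small_chain_count (lift a) = card (layers a)"
    using assms by (simp add: small_chain_count_dyck dyck_lift card_small_chains_lift)
  show ?thesis
  proof (cases "a = []")
    case True
    \<comment> \<open>The empty path has no valley; the convention in \<open>v_count\<close> matches
      the single constant sequence.\<close>
    have "layers [] = {\<lambda>_. []}"
      by (auto simp: layers_def path_le_def)
    moreover have "{s. dyck s \<and> length s = length a \<and> a \<preceq> s} = {[]}"
      using True by (auto simp: dyck_def)
    moreover have "path_interval [] [] = {[]}"
      by (auto simp: path_interval_def path_le_def)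
    ultimately show ?thesis using 1 True by (simp add: v_count_def upper_count_def)
  next
    case False
    with 1 show ?thesis using assms by (simp add: card_layers card_v_flags)
  qed
qed

end
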